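(* Let $(R,B)\in\mathcal{D}_d$ with $R=\mathrm{diag}(m_1,\dots,m_d)$ and $m_1,\dots,m_d\ge d+1$. Let $(p_b)_{b\in B}$ be positive weights and $\lambda=\sum_{b\in B}p_b\delta_b$. Let $\mu$ be a finite nonzero Borel measure on $\mathbb{R}^d$ with $\operatorname{spt}(\mu)\subseteq[0,1]^d$, and set $\nu=(\lambda*\mu)\circ R$, i.e., $\nu(F)=(\lambda*\mu)(RF)$ for Borel $F$. Then there is a Borel set $E\subseteq\mathbb{R}^d$ with $\nu(E)>0$ and $\nu(E+n)=0$ for all $n\in\mathbb{Z}^d\setminus\{\mathbf{0}\}$.
   Context: $\mathcal{D}_d$ is the set of pairs $(R,B)$ with $R=\mathrm{diag}(m_1,\dots,m_d)$, $m_1,\dots,m_d\ge2$ integers, and $B$ a nonempty subset of $\{0,\dots,m_1-1\}\times\cdots\times\{0,\dots,m_d-1\}$. $\operatorname{spt}(\mu)$ denotes the support of $\mu$ (smallest closed set of full measure). *)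

theory Defs
  imports "HOL-Analysis.Analysis" "HOL-Probability.Probability"
begin

text \<open>Support of a Borel measure: the smallest closed set of full measure,
  i.e. the intersection of all closed sets whose complement is null.\<close>
definition spt :: "('a::topological_space) measure \<Rightarrow> 'a set" where
  "spt M = \<Inter>{C. closed C \<and> emeasure M (UNIV - C) = 0}"

text \<open>The discrete measure lambda = sum over b in B of p b times the Dirac mass at b.\<close>
definition weighted_dirac :: "('a::topological_space) set \<Rightarrow> ('a \<Rightarrow> real) \<Rightarrow> 'a measure" where
  "weighted_dirac B p =
     measure_of UNIV (sets borel) (\<lambda>A. \<Sum>b\<in>B. ennreal (p b) * indicator A b)"

text \<open>Convolution of two Borel measures on a vector space: pushforward of the
  product measure under addition.\<close>
definition conv :: "('a::real_normed_vector) measure \<Rightarrow> 'a measure \<Rightarrow> 'a measure" where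
  "conv M N = distr (M \<Otimes>\<^sub>M N) borel (\<lambda>(x, y). x + y)"

text \<open>The diagonal matrix diag(m_1,...,m_d).\<close>
definition diag_mat :: "('n::finite \<Rightarrow> nat) \<Rightarrow> real^'n^'n" where
  "diag_mat m = (\<chi> i j. if i = j then real (m i) else 0)"

text \<open>Pullback M o R: (M o R)(F) = M(R F) for Borel F.\<close>
definition pullback_mat :: "(real^'n::finite) measure \<Rightarrow> real^'n^'n \<Rightarrow> (real^'n) measure" where
  "pullback_mat M R = measure_of UNIV (sets borel) (\<lambda>F. emeasure M ((\<lambda>x. R *v x) ` F))"

end

theory Submission
  imports Defs
begin

text \<open>Choose a digit \<open>b \<in> B\<close> closest to the centre \<open>c = ((m i - 1) / 2)\<^sub>i\<close> of the digit
  box and put \<open>\<phi> x = (c - b) \<bullet> x\<close>. Let \<open>v = b - b' + R n\<close> with \<open>b' \<in> B\<close> and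
  \<open>0 \<noteq> n \<in> \<int>\<^sup>d\<close>, and suppose that \<open>w\<close> and \<open>w + v\<close> both lie in \<open>[0,1]\<^sup>d\<close>, so that
  \<open>|v i| \<le> 1\<close>. Coordinatewise
  \<open>(c i - b i) v i \<ge> \<beta> i / 2 + ((b' i - c i)\<^sup>2 - (b i - c i)\<^sup>2) / 2\<close>, where \<open>\<beta> i = -1\<close> if
  \<open>n i = 0\<close> and \<open>\<beta> i = m i - 1 \<ge> d\<close> otherwise (then \<open>b i\<close> and \<open>b' i\<close> sit at opposite ends of
  \<open>{0..m i - 1}\<close>). Summing, and using \<open>|b - c| \<le> |b' - c|\<close>, gives \<open>\<phi> v \<ge> 1 / 2\<close>.
  As \<open>\<mu>\<close> is carried by \<open>[0,1]\<^sup>d\<close>, some level \<open>t\<close> has \<open>\<mu>{\<phi> > t} > 0 = \<mu>{\<phi> > t + 1/2}\<close>,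
  so \<open>A = [0,1]\<^sup>d \<inter> {\<phi> > t}\<close> has \<open>\<mu>(A + v) = 0\<close> for all such \<open>v\<close>. Finally
  \<open>\<nu> F = \<Sum>\<^sub>b p b \<mu>(R F - b)\<close>, so \<open>E = R\<^sup>-\<^sup>1(b + A)\<close> has \<open>\<nu> E \<ge> p b \<mu> A > 0\<close> and
  \<open>\<nu>(E + n) = \<Sum>\<^sub>b\<^sub>' p b' \<mu>(A + b - b' + R n) = 0\<close>.\<close>

section \<open>Lattice shifts between digits\<close>

lemma grid_coordinate_shift_bound:
  fixes k k' M :: nat and z :: int
  assumes "k < M" "k' < M" and small: "\<bar>real k - real k' + real M * z\<bar> \<le> 1"
  defines "c \<equiv> (real M - 1) / 2"
  shows "(if z = 0 then -1 else real M - 1) / 2 + ((real k' - c)\<^sup>2 - (real k - c)\<^sup>2) / 2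
           \<le> (c - real k) * (real k - real k' + real M * z)"
proof -
  define u where "u = int k - int k' + int M * z"
  have "real_of_int u = real k - real k' + real M * z" unfolding u_def by simp
  then have "real_of_int \<bar>u\<bar> \<le> 1" using small by simp
  then have u: "\<bar>u\<bar> \<le> 1" by linarith
  have Mz: "int M * z = int k' - int k + u" unfolding u_def by simp
  have "z \<le> 1"
  proof (rule ccontr)
    assume "\<not> z \<le> 1"
    then have "int M * 2 \<le> int M * z" by (intro mult_left_mono) auto
    then show False using Mz u assms(1,2) by linarith
  qed
  moreover have "-1 \<le> z"
  proof (rule ccontr)
    assume "\<not> -1 \<le> z"
    then have "int M * z \<le> int M * (-2)" by (intro mult_left_mono) auto
    then show False using Mz u assms(1,2) by linarith
  qed
  ultimately consider "z = 0" | "z = 1" | "z = -1" by linarith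
  then show ?thesis
  proof cases
    case 1
    then have v: "real k - real k' + real M * z = u" and k': "real k' = real k - u"
      unfolding u_def by simp_all
    have "(c - real k) * u - (-1/2 + ((real k' - c)\<^sup>2 - (real k - c)\<^sup>2) / 2) = (1 - (real_of_int u)\<^sup>2) / 2"
      unfolding k' by (simp add: power2_eq_square field_simps)
    moreover have "0 \<le> (1 - (real_of_int u)\<^sup>2) / 2"
      using u by (simp add: abs_square_le_1)
    ultimately have "-1/2 + ((real k' - c)\<^sup>2 - (real k - c)\<^sup>2) / 2 \<le> (c - real k) * u"
      by (metis diff_ge_0_iff_ge)
    then show ?thesis using 1 v by simp
  next
    case 2
    then have "int M = int k' - int k + u" using Mz by simp
    then have "k = 0" "k' = M - 1" using u assms(1,2) by linarith+
    then have "real k = 0" "real k' - c = c" "real k - real k' + real M * z = 1"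
      using 2 assms(2) unfolding c_def by (simp_all add: field_simps)
    then show ?thesis using 2 by simp
  next
    case 3
    then have "- int M = int k' - int k + u" using Mz by simp
    then have "k = M - 1" "k' = 0" using u assms(1,2) by linarith+
    then have "real k' = 0" "real k - c = c" "real k - real k' + real M * z = -1"
      using 3 assms(1) unfolding c_def by (simp_all add: field_simps)
    then show ?thesis using 3 by simp
  qed
qed

lemma sum_ge_1_if_term_ge_card:
  fixes f :: "'a \<Rightarrow> real"
  assumes "finite S" "j \<in> S" "real (card S) \<le> f j" "\<And>i. i \<in> S \<Longrightarrow> -1 \<le> f i"
  shows "1 \<le> sum f S"
proof -
  have "(\<Sum>i\<in>S - {j}. -1) \<le> sum f (S - {j})"
    using assms(4) by (intro sum_mono) auto
  moreover have "card S \<ge> 1"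
    using assms(1,2) card_0_eq by fastforce
  ultimately show ?thesis
    using assms(3) sum.remove[OF assms(1,2), of f] by (simp add: card_Diff_singleton[OF assms(2)])
qed

lemma dist_vec_power2: "(dist x y)\<^sup>2 = (\<Sum>i\<in>UNIV. (x $ i - y $ i)\<^sup>2)"
  for x y :: "real^'n"
  by (simp add: dist_vec_def L2_set_def dist_real_def sum_nonneg)

lemma diag_mat_mult: "diag_mat m *v x = (\<chi> i. real (m i) * x $ i)"
  by (simp add: diag_mat_def matrix_vector_mult_def vec_eq_iff if_distrib[of "\<lambda>a. a * _"] cong: if_cong)

definition grid_centre :: "('n::finite \<Rightarrow> nat) \<Rightarrow> real^'n" where
  "grid_centre m = (\<chi> i. (real (m i) - 1) / 2)"

lemma grid_shift_inner_ge:
  fixes m :: "'n::finite \<Rightarrow> nat" and b b' n :: "real^'n"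
  assumes m_ge: "\<And>i. CARD('n) + 1 \<le> m i"
    and b: "\<forall>i. b $ i \<in> real ` {..<m i}" and b': "\<forall>i. b' $ i \<in> real ` {..<m i}"
    and closest: "dist b (grid_centre m) \<le> dist b' (grid_centre m)"
    and n_int: "\<forall>i. n $ i \<in> \<int>" and n_nz: "n \<noteq> 0"
    and small: "\<forall>i. \<bar>(b - b' + diag_mat m *v n) $ i\<bar> \<le> 1"
  shows "1 / 2 \<le> (grid_centre m - b) \<bullet> (b - b' + diag_mat m *v n)"
proof -
  define c where "c = grid_centre m"
  define v where "v = b - b' + diag_mat m *v n"
  define bound where "bound i = (if n $ i = 0 then -1 else real (m i) - 1)" for i
  have coordinate: "bound i / 2 + ((b' $ i - c $ i)\<^sup>2 - (b $ i - c $ i)\<^sup>2) / 2 \<le> (c $ i - b $ i) * v $ i"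
    for i
  proof -
    obtain k k' z where k: "k < m i" "b $ i = real k" and k': "k' < m i" "b' $ i = real k'"
      and z: "n $ i = of_int z"
      using b b' n_int by (meson Ints_cases imageE lessThan_iff)
    have "v $ i = real k - real k' + real (m i) * z"
      using k k' z by (simp add: v_def diag_mat_mult)
    moreover have "\<bar>v $ i\<bar> \<le> 1"
      using small by (simp add: v_def)
    ultimately show ?thesis
      using grid_coordinate_shift_bound[OF k(1) k'(1)] k k' z
      by (simp add: bound_def c_def grid_centre_def)
  qed
  obtain j where "n $ j \<noteq> 0"
    using n_nz by (metis vec_eq_iff zero_index)
  then have "1 \<le> (\<Sum>i\<in>UNIV. bound i)"
    using m_ge[of j] by (intro sum_ge_1_if_term_ge_card[of UNIV j]) (auto simp: bound_def)
  moreover have "0 \<le> (\<Sum>i\<in>UNIV. (b' $ i - c $ i)\<^sup>2 - (b $ i - c $ i)\<^sup>2)"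
    using power_mono[OF closest, of 2]
    by (simp add: c_def dist_vec_power2 sum_subtractf)
  ultimately have "1 / 2 \<le> (\<Sum>i\<in>UNIV. bound i / 2 + ((b' $ i - c $ i)\<^sup>2 - (b $ i - c $ i)\<^sup>2) / 2)"
    by (simp add: sum.distrib sum_divide_distrib[symmetric])
  also have "\<dots> \<le> (\<Sum>i\<in>UNIV. (c $ i - b $ i) * v $ i)"
    by (intro sum_mono coordinate)
  finally show ?thesis
    by (simp add: c_def v_def inner_vec_def)
qed

lemma grid_shift_gap_in_unit_cube:
  fixes m :: "'n::finite \<Rightarrow> nat" and b b' n w :: "real^'n"
  assumes "\<And>i. CARD('n) + 1 \<le> m i"
    and "\<forall>i. b $ i \<in> real ` {..<m i}" "\<forall>i. b' $ i \<in> real ` {..<m i}"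
    and "dist b (grid_centre m) \<le> dist b' (grid_centre m)"
    and "\<forall>i. n $ i \<in> \<int>" "n \<noteq> 0"
    and w: "w \<in> cbox 0 1" "w + (b - b' + diag_mat m *v n) \<in> cbox 0 1"
  shows "(grid_centre m - b) \<bullet> w + 1 / 2 \<le> (grid_centre m - b) \<bullet> (w + (b - b' + diag_mat m *v n))"
proof -
  have "\<bar>(b - b' + diag_mat m *v n) $ i\<bar> \<le> 1" for i
    using w by (auto simp: mem_box_cart abs_le_iff dest!: spec[of _ i])
  then show ?thesis
    using grid_shift_inner_ge[OF assms(1-6)] by (simp add: inner_add_right)
qed

lemma finite_grid: "finite {b::real^'n. \<forall>i. b $ i \<in> real ` {..<m i}}"
proof -
  have "{b::real^'n. \<forall>i. b $ i \<in> real ` {..<m i}} \<subseteq> vec_lambda ` (PiE UNIV (\<lambda>i. real ` {..<m i}))"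
    by (auto intro!: image_eqI[of _ _ "vec_nth _"] simp: PiE_iff)
  then show ?thesis
    by (rule finite_subset) (intro finite_imageI finite_PiE; simp)
qed

lemma invertible_diag_mat:
  "(\<And>i. m i \<noteq> 0) \<Longrightarrow> invertible (diag_mat m)"
  by (simp add: invertible_det_nz det_diagonal diag_mat_def)

section \<open>Positive sets with null translates\<close>

lemma emeasure_compl_eq_0_if_spt_subset:
  fixes \<mu> :: "'a::second_countable_topology measure"
  assumes sets: "sets \<mu> = sets borel" and spt: "spt \<mu> \<subseteq> K" and "closed K"
  shows "emeasure \<mu> (- K) = 0"
proof -
  define U where "U = uminus ` {C. closed C \<and> emeasure \<mu> (- C) = 0}"
  have "open N" if "N \<in> U" for N
    using that by (auto simp: U_def)
  \<comment> \<open>The union of all null open sets is a countable subunion, by Lindelof.\<close>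
  then obtain U' where U': "U' \<subseteq> U" "countable U'" "\<Union>U' = \<Union>U"
    using Lindelof by metis
  have "N \<in> null_sets \<mu>" if N: "N \<in> U" for N
  proof -
    obtain C where "closed C" "emeasure \<mu> (- C) = 0" "N = - C"
      using N by (auto simp: U_def)
    then show ?thesis
      by (simp add: null_sets_def sets borel_open open_Compl)
  qed
  then have "(\<Union>N\<in>U'. N) \<in> null_sets \<mu>"
    using U'(1) by (intro null_sets_UN'[OF U'(2)]) blast
  then have "\<Union>U \<in> null_sets \<mu>"
    using U'(3) by simp
  moreover have "- K \<in> sets \<mu>"
    using \<open>closed K\<close> by (simp add: sets borel_open open_Compl)
  moreover have "- K \<subseteq> \<Union>U"
  proof
    fix x assume "x \<in> - K"
    then obtain C where "closed C" "emeasure \<mu> (- C) = 0" "x \<notin> C"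
      using spt by (auto simp: spt_def Compl_eq_Diff_UNIV)
    then show "x \<in> \<Union>U"
      by (auto simp: U_def)
  qed
  ultimately have "- K \<in> null_sets \<mu>"
    by (rule null_sets_subset)
  then show ?thesis
    by auto
qed

lemma exists_level_gap:
  fixes f :: "'a \<Rightarrow> real"
  assumes f: "f \<in> borel_measurable M" and nz: "emeasure M (space M) \<noteq> 0"
    and bdd: "AE x in M. f x \<le> C" and "0 < \<delta>"
  shows "\<exists>t. 0 < emeasure M {x\<in>space M. t < f x} \<and> emeasure M {x\<in>space M. t + \<delta> < f x} = 0"
proof -
  define S where "S = {t. 0 < emeasure M {x\<in>space M. t < f x}}"
  have meas: "{x\<in>space M. t < f x} \<in> sets M" for t
    using f by measurable
  have "t < C" if "t \<in> S" for t
  proof (rule ccontr)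
    assume "\<not> t < C"
    have "AE x in M. x \<notin> {x\<in>space M. t < f x}"
      using bdd by eventually_elim (use \<open>\<not> t < C\<close> in auto)
    then have "{x\<in>space M. t < f x} \<in> null_sets M"
      by (rule AE_iff_null_sets[OF meas, THEN iffD2])
    then show False
      using that by (auto simp: S_def)
  qed
  then have "bdd_above S"
    by (meson bdd_aboveI less_imp_le)
  moreover have "S \<noteq> {}"
  proof
    assume "S = {}"
    then have "(\<Union>k::nat. {x\<in>space M. - real k < f x}) \<in> null_sets M"
      using meas by (intro null_sets_UN) (auto simp: S_def null_sets_def)
    moreover have "(\<Union>k::nat. {x\<in>space M. - real k < f x}) = space M"
      by auto (meson minus_less_iff reals_Archimedean2)
    ultimately show False
      using nz by auto
  qed
  \<comment> \<open>\<open>Sup S\<close> is the essential supremum of \<open>f\<close>.\<close>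
  ultimately obtain t where "t \<in> S" "Sup S - \<delta> < t"
    using less_cSup_iff[of S "Sup S - \<delta>"] \<open>0 < \<delta>\<close> by auto
  moreover have "t + \<delta> \<notin> S"
    using cSup_upper[OF _ \<open>bdd_above S\<close>, of "t + \<delta>"] calculation(2) by auto
  ultimately show ?thesis
    by (auto simp: S_def)
qed

lemma exists_positive_set_null_translates:
  fixes \<mu> :: "'a::real_normed_vector measure" and \<phi> :: "'a \<Rightarrow> real"
  assumes sets: "sets \<mu> = sets borel" and nz: "emeasure \<mu> UNIV \<noteq> 0"
    and K: "compact K" "emeasure \<mu> (- K) = 0"
    and \<phi>: "continuous_on UNIV \<phi>" and "0 < \<delta>"
    and gap: "\<And>v w. v \<in> V \<Longrightarrow> w \<in> K \<Longrightarrow> w + v \<in> K \<Longrightarrow> \<phi> w + \<delta> \<le> \<phi> (w + v)"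
  shows "\<exists>A\<in>sets borel. 0 < emeasure \<mu> A \<and> (\<forall>v\<in>V. emeasure \<mu> ((\<lambda>x. x + v) ` A) = 0)"
proof -
  have space: "space \<mu> = UNIV"
    using sets_eq_imp_space_eq[OF sets] by simp
  have "closed K"
    using K(1) by (rule compact_imp_closed)
  then have K_meas: "- K \<in> sets \<mu>" "K \<in> sets \<mu>"
    by (simp_all add: sets borel_closed borel_open open_Compl)
  have level_meas: "{x. t < \<phi> x} \<in> sets \<mu>" for t
    unfolding sets by (intro borel_open open_Collect_less continuous_on_const \<phi>)
  have "bounded (\<phi> ` K)"
    using K(1) \<phi> by (intro compact_imp_bounded compact_continuous_image) (auto intro: continuous_on_subset)
  then obtain C where C: "\<forall>x\<in>K. \<phi> x \<le> C"
    unfolding bounded_real by (meson abs_le_D1 image_eqI)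
  have "AE x in \<mu>. \<phi> x \<le> C"
    using C K(2) K_meas(1) by (intro AE_I[of _ _ "- K"]) auto
  moreover have "\<phi> \<in> borel_measurable \<mu>"
    unfolding measurable_cong_sets[OF sets refl] by (rule borel_measurable_continuous_onI[OF \<phi>])
  ultimately obtain t where pos: "0 < emeasure \<mu> {x. t < \<phi> x}" and null: "emeasure \<mu> {x. t + \<delta> < \<phi> x} = 0"
    using exists_level_gap[of \<phi> \<mu> C \<delta>] nz \<open>0 < \<delta>\<close> by (auto simp: space)
  define A where "A = K \<inter> {x. t < \<phi> x}"
  have "A \<in> sets borel"
    using K_meas level_meas sets by (simp add: A_def)
  moreover have "0 < emeasure \<mu> A"
  proof -
    have "emeasure \<mu> {x. t < \<phi> x} \<le> emeasure \<mu> (A \<union> - K)"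
      using \<open>A \<in> sets borel\<close> K_meas sets by (intro emeasure_mono) (auto simp: A_def)
    also have "\<dots> \<le> emeasure \<mu> A + emeasure \<mu> (- K)"
      using \<open>A \<in> sets borel\<close> K_meas sets by (intro emeasure_subadditive) auto
    finally show ?thesis
      using pos K(2) by simp
  qed
  moreover have "emeasure \<mu> ((\<lambda>x. x + v) ` A) = 0" if "v \<in> V" for v
  proof -
    have "(\<lambda>x. x + v) ` A \<subseteq> - K \<union> {x. t + \<delta> < \<phi> x}"
      using gap[OF that] by (fastforce simp: A_def)
    then have "emeasure \<mu> ((\<lambda>x. x + v) ` A) \<le> emeasure \<mu> (- K \<union> {x. t + \<delta> < \<phi> x})"
      using K_meas level_meas by (intro emeasure_mono) auto
    also have "\<dots> \<le> emeasure \<mu> (- K) + emeasure \<mu> {x. t + \<delta> < \<phi> x}"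
      using K_meas level_meas by (intro emeasure_subadditive) auto
    finally show ?thesis
      using K(2) null by simp
  qed
  ultimately show ?thesis
    by blast
qed

section \<open>The measures \<open>\<lambda> * \<mu>\<close> and \<open>(\<lambda> * \<mu>) \<circ> R\<close>\<close>

lemma image_in_sets_borel_if_continuous_inverse:
  fixes f g :: "'a::topological_space \<Rightarrow> 'a"
  assumes g: "continuous_on UNIV g" and "\<And>x. g (f x) = x" "\<And>y. f (g y) = y"
    and S: "S \<in> sets borel"
  shows "f ` S \<in> sets borel"
proof -
  have "f ` S = g -` S"
    using assms(2,3) by (auto simp: assms(2)) (metis image_eqI)
  then show ?thesis
    using measurable_sets[OF borel_measurable_continuous_onI[OF g] S] by simp
qed

lemma translation_in_sets_borel:
  fixes a :: "'a::real_normed_vector"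
  shows "S \<in> sets borel \<Longrightarrow> (\<lambda>x. x + a) ` S \<in> sets borel"
  by (rule image_in_sets_borel_if_continuous_inverse[where g = "\<lambda>x. x - a"])
    (auto simp: continuous_on_diff)

lemma matrix_image_in_sets_borel:
  fixes R :: "real^'n^'n"
  assumes "invertible R" "S \<in> sets borel"
  shows "(*v) R ` S \<in> sets borel"
proof -
  obtain R' where "R ** R' = mat 1" "R' ** R = mat 1"
    using assms(1) by (auto simp: invertible_def)
  then show ?thesis
    using assms(2) by (intro image_in_sets_borel_if_continuous_inverse[where g = "(*v) R'"])
      (auto simp: matrix_vector_mult_linear_continuous_on matrix_vector_mul_assoc)
qed

lemma matrix_vimage_in_sets_borel:
  fixes R :: "real^'n^'m"
  shows "S \<in> sets borel \<Longrightarrow> (*v) R -` S \<in> sets borel"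
  using measurable_sets[OF borel_measurable_continuous_onI[OF matrix_vector_mult_linear_continuous_on]]
  by simp

lemma sets_weighted_dirac: "sets (weighted_dirac B p) = sets borel"
  unfolding weighted_dirac_def using sets.sigma_sets_eq[of borel] by simp

lemma space_weighted_dirac: "space (weighted_dirac B p) = UNIV"
  unfolding weighted_dirac_def by (simp add: space_measure_of_conv)

lemma emeasure_weighted_dirac:
  assumes "X \<in> sets borel"
  shows "emeasure (weighted_dirac B p) X = (\<Sum>b\<in>B. ennreal (p b) * indicator X b)"
  unfolding weighted_dirac_def
proof (rule emeasure_measure_of_sigma)
  show "countably_additive (sets borel) (\<lambda>A. \<Sum>b\<in>B. ennreal (p b) * indicator A b)"
  proof (rule countably_additiveI)
    fix A :: "nat \<Rightarrow> 'a set"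
    assume "disjoint_family A"
    then show "(\<Sum>i. \<Sum>b\<in>B. ennreal (p b) * indicator (A i) b)
        = (\<Sum>b\<in>B. ennreal (p b) * indicator (\<Union>i. A i) b)"
      by (simp add: suminf_sum[OF summableI] suminf_indicator)
  qed
qed (use assms sets.sigma_algebra_axioms[of borel] in \<open>auto simp: positive_def\<close>)

lemma finite_measure_weighted_dirac: "finite B \<Longrightarrow> finite_measure (weighted_dirac B p)"
  by (rule finite_measureI) (simp add: space_weighted_dirac emeasure_weighted_dirac ennreal_mult_eq_top_iff)

lemma emeasure_conv_weighted_dirac:
  fixes \<mu> :: "'a::euclidean_space measure"
  assumes "finite B" and sets: "sets \<mu> = sets borel" and "sigma_finite_measure \<mu>"
    and S: "S \<in> sets borel"
  shows "emeasure (conv (weighted_dirac B p) \<mu>) S = (\<Sum>b\<in>B. ennreal (p b) * emeasure \<mu> {y. b + y \<in> S})"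
proof -
  let ?L = "weighted_dirac B p"
  interpret L: finite_measure ?L
    using \<open>finite B\<close> by (rule finite_measure_weighted_dirac)
  interpret pair_sigma_finite ?L \<mu>
    by (simp add: pair_sigma_finite_def L.sigma_finite_measure_axioms assms(3))
  have space: "space \<mu> = UNIV"
    using sets_eq_imp_space_eq[OF sets] by simp
  have translate_meas: "{y. b + y \<in> S} \<in> sets borel" for b
    using measurable_sets[OF borel_measurable_continuous_onI S, of "\<lambda>y. b + y"]
    by (simp add: vimage_def continuous_on_add)
  have add: "(\<lambda>(x, y). x + y) \<in> ?L \<Otimes>\<^sub>M \<mu> \<rightarrow>\<^sub>M borel"
    unfolding measurable_cong_sets[OF sets_pair_measure_cong[OF sets_weighted_dirac sets] refl]
    by measurable
  have "emeasure (conv ?L \<mu>) S = emeasure (?L \<Otimes>\<^sub>M \<mu>) ((\<lambda>(x, y). x + y) -` S \<inter> space (?L \<Otimes>\<^sub>M \<mu>))"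
    unfolding conv_def by (rule emeasure_distr[OF add S])
  also have "\<dots> = (\<integral>\<^sup>+ y. emeasure ?L {x. x + y \<in> S} \<partial>\<mu>)"
    using measurable_sets[OF add S]
    by (simp add: emeasure_pair_measure_alt2 space_pair_measure space_weighted_dirac space vimage_def)
  also have "\<dots> = (\<integral>\<^sup>+ y. (\<Sum>b\<in>B. ennreal (p b) * indicator {y. b + y \<in> S} y) \<partial>\<mu>)"
    using translate_meas
    by (intro nn_integral_cong) (simp add: emeasure_weighted_dirac indicator_def add.commute)
  also have "\<dots> = (\<Sum>b\<in>B. ennreal (p b) * emeasure \<mu> {y. b + y \<in> S})"
    using translate_meas sets by (simp add: nn_integral_sum nn_integral_cmult_indicator)
  finally show ?thesis .
qed

lemma emeasure_pullback_mat:
  fixes M :: "(real^'n) measure"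
  assumes R: "invertible R" and sets: "sets M = sets borel" and F: "F \<in> sets borel"
  shows "emeasure (pullback_mat M R) F = emeasure M ((*v) R ` F)"
  unfolding pullback_mat_def
proof (rule emeasure_measure_of_sigma)
  show "countably_additive (sets borel) (\<lambda>F. emeasure M ((*v) R ` F))"
  proof (rule countably_additiveI)
    fix A :: "nat \<Rightarrow> (real^'n) set"
    assume "range A \<subseteq> sets borel" "disjoint_family A"
    moreover have "inj ((*v) R)"
      using R by (rule inj_matrix_vector_mult)
    ultimately show "(\<Sum>i. emeasure M ((*v) R ` A i)) = emeasure M ((*v) R ` (\<Union>i. A i))"
      using R sets by (subst suminf_emeasure)
        (auto simp: image_UN matrix_image_in_sets_borel disjoint_family_on_def inj_image_eq_iff
          simp flip: image_Int)
  qed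
qed (use F sets.sigma_algebra_axioms[of borel] in \<open>auto simp: positive_def\<close>)

lemma emeasure_pullback_conv_weighted_dirac_translate:
  fixes \<mu> :: "(real^'n) measure"
  assumes R: "invertible R" and "finite B" "sets \<mu> = sets borel" "sigma_finite_measure \<mu>"
    and A: "A \<in> sets borel"
  shows "emeasure (pullback_mat (conv (weighted_dirac B p) \<mu>) R)
           ((\<lambda>x. x + n) ` ((*v) R -` ((\<lambda>x. x + a) ` A)))
         = (\<Sum>b\<in>B. ennreal (p b) * emeasure \<mu> ((\<lambda>x. x + (a - b + R *v n)) ` A))"
proof -
  define E where "E = (*v) R -` ((\<lambda>x. x + a) ` A)"
  have "surj ((*v) R)"
    using R by (simp add: invertible_eq_bij bij_is_surj)
  then have image: "(*v) R ` ((\<lambda>x. x + n) ` E) = (\<lambda>x. x + (a + R *v n)) ` A"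
    by (simp add: E_def image_image matrix_vector_right_distrib surj_image_vimage_eq add.assoc
        flip: image_image[of "\<lambda>y. y + R *v n" "(*v) R"])
  have "E \<in> sets borel"
    unfolding E_def by (intro matrix_vimage_in_sets_borel translation_in_sets_borel A)
  then have "emeasure (pullback_mat (conv (weighted_dirac B p) \<mu>) R) ((\<lambda>x. x + n) ` E)
      = emeasure (conv (weighted_dirac B p) \<mu>) ((\<lambda>x. x + (a + R *v n)) ` A)"
    by (simp add: emeasure_pullback_mat[OF R] conv_def translation_in_sets_borel image)
  also have "\<dots> = (\<Sum>b\<in>B. ennreal (p b) * emeasure \<mu> {y. b + y \<in> (\<lambda>x. x + (a + R *v n)) ` A})"
    using assms(2-4) by (intro emeasure_conv_weighted_dirac translation_in_sets_borel A)
  also have "\<dots> = (\<Sum>b\<in>B. ennreal (p b) * emeasure \<mu> ((\<lambda>x. x + (a - b + R *v n)) ` A))"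
    by (intro sum.cong arg_cong2[where f = "(*)"] arg_cong[where f = "emeasure \<mu>"])
      (auto simp: image_iff algebra_simps)
  finally show ?thesis
    by (simp add: E_def)
qed

lemma pullback_conv_weighted_dirac_null_translates:
  fixes \<mu> :: "(real^'n) measure"
  assumes R: "invertible R" and B: "finite B" "b \<in> B" "0 < p b"
    and \<mu>: "sets \<mu> = sets borel" "sigma_finite_measure \<mu>"
    and A: "A \<in> sets borel" "0 < emeasure \<mu> A"
    and null: "\<And>b' n. b' \<in> B \<Longrightarrow> n \<in> N \<Longrightarrow> emeasure \<mu> ((\<lambda>x. x + (b - b' + R *v n)) ` A) = 0"
  shows "\<exists>E\<in>sets borel. 0 < emeasure (pullback_mat (conv (weighted_dirac B p) \<mu>) R) E \<and>
           (\<forall>n\<in>N. emeasure (pullback_mat (conv (weighted_dirac B p) \<mu>) R) ((\<lambda>x. x + n) ` E) = 0)"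
proof (intro bexI conjI ballI)
  let ?\<nu> = "pullback_mat (conv (weighted_dirac B p) \<mu>) R"
  define E where "E = (*v) R -` ((\<lambda>x. x + b) ` A)"
  have \<nu>: "emeasure ?\<nu> ((\<lambda>x. x + n) ` E)
      = (\<Sum>b'\<in>B. ennreal (p b') * emeasure \<mu> ((\<lambda>x. x + (b - b' + R *v n)) ` A))" for n
    unfolding E_def using R B(1) \<mu> A(1) by (rule emeasure_pullback_conv_weighted_dirac_translate)
  show "E \<in> sets borel"
    unfolding E_def by (intro matrix_vimage_in_sets_borel translation_in_sets_borel A)
  have "0 < ennreal (p b) * emeasure \<mu> A"
    using B(3) A(2) by (simp add: ennreal_zero_less_mult_iff)
  also have "\<dots> \<le> (\<Sum>b'\<in>B. ennreal (p b') * emeasure \<mu> ((\<lambda>x. x + (b - b' + R *v 0)) ` A))"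
    using member_le_sum[OF B(2) _ B(1), of "\<lambda>b'. ennreal (p b') * emeasure \<mu> ((\<lambda>x. x + (b - b' + R *v 0)) ` A)"]
    by simp
  also have "\<dots> = emeasure ?\<nu> E"
    using \<nu>[of 0] by simp
  finally show "0 < emeasure ?\<nu> E" .
  fix n assume "n \<in> N"
  then show "emeasure ?\<nu> ((\<lambda>x. x + n) ` E) = 0"
    by (simp add: \<nu> null)
qed

theorem theorem4p1:
  fixes m :: "'n::finite \<Rightarrow> nat"
    and B :: "(real^'n) set"
    and p :: "real^'n \<Rightarrow> real"
    and \<mu> :: "(real^'n) measure"
  assumes m_ge: "\<And>i. m i \<ge> CARD('n) + 1"
    and B_ne: "B \<noteq> {}"
    and B_sub: "B \<subseteq> {b. \<forall>i. b $ i \<in> real ` {..<m i}}"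
    and p_pos: "\<And>b. b \<in> B \<Longrightarrow> p b > 0"
    and \<mu>_borel: "sets \<mu> = sets borel"
    and \<mu>_fin: "emeasure \<mu> UNIV < \<infinity>"
    and \<mu>_nz: "emeasure \<mu> UNIV \<noteq> 0"
    and \<mu>_spt: "spt \<mu> \<subseteq> {x. \<forall>i. 0 \<le> x $ i \<and> x $ i \<le> 1}"
  shows "\<exists>E \<in> sets borel.
           emeasure (pullback_mat (conv (weighted_dirac B p) \<mu>) (diag_mat m)) E > 0 \<and>
           (\<forall>n. (\<forall>i. n $ i \<in> \<int>) \<and> n \<noteq> 0 \<longrightarrow>
              emeasure (pullback_mat (conv (weighted_dirac B p) \<mu>) (diag_mat m))
                ((\<lambda>x. x + n) ` E) = 0)"
proof -
  let ?R = "diag_mat m" and ?c = "grid_centre m"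
  have R: "invertible ?R"
    using m_ge by (intro invertible_diag_mat) (metis add_is_0 le_zero_eq one_neq_zero)
  have "finite B"
    using B_sub finite_grid by (rule finite_subset)
  then obtain b where b: "b \<in> B" and closest: "\<forall>b'\<in>B. dist b ?c \<le> dist b' ?c"
    using ex_is_arg_min_if_finite[OF _ B_ne, of "\<lambda>b. dist b ?c"] by (auto simp: is_arg_min_linorder)
  define V where "V = {b - b' + ?R *v n | b' n. b' \<in> B \<and> (\<forall>i. n $ i \<in> \<int>) \<and> n \<noteq> 0}"
  have cube: "{x. \<forall>i. 0 \<le> x $ i \<and> x $ i \<le> 1} = cbox 0 (1::real^'n)"
    by (auto simp: mem_box_cart)
  have gap: "(?c - b) \<bullet> w + 1 / 2 \<le> (?c - b) \<bullet> (w + v)"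
    if "v \<in> V" "w \<in> cbox 0 1" "w + v \<in> cbox 0 1" for v w
    using that B_sub b closest m_ge by (auto simp: V_def intro!: grid_shift_gap_in_unit_cube)
  have cube_null: "emeasure \<mu> (- cbox 0 1) = 0"
    using \<mu>_spt by (intro emeasure_compl_eq_0_if_spt_subset \<mu>_borel) (simp_all add: cube closed_cbox)
  obtain A where A: "A \<in> sets borel" "0 < emeasure \<mu> A"
    and null: "\<forall>v\<in>V. emeasure \<mu> ((\<lambda>x. x + v) ` A) = 0"
    using exists_positive_set_null_translates[where \<phi> = "\<lambda>x. (?c - b) \<bullet> x" and \<delta> = "1 / 2",
        OF \<mu>_borel \<mu>_nz compact_cbox cube_null _ _ gap]
    by (auto simp: continuous_on_inner)
  have null_lattice: "emeasure \<mu> ((\<lambda>x. x + (b - b' + ?R *v n)) ` A) = 0"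
    if "b' \<in> B" "n \<in> {n. (\<forall>i. n $ i \<in> \<int>) \<and> n \<noteq> 0}" for b' n
    using null that unfolding V_def by blast
  have "sigma_finite_measure \<mu>"
    using \<mu>_fin sets_eq_imp_space_eq[OF \<mu>_borel] by (intro finite_measure.axioms(1) finite_measureI) simp
  from pullback_conv_weighted_dirac_null_translates[where p = p and N = "{n. (\<forall>i. n $ i \<in> \<int>) \<and> n \<noteq> 0}",
      OF R \<open>finite B\<close> b p_pos[OF b] \<mu>_borel this A null_lattice]
  show ?thesis
    by (simp add: Ball_def)
qed

end
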